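(* Let $r\ge 3$ and let $\lambda=(2,1^{r-2},2)$, a composition of $n=r+2$ with $r$ parts. Then $Y(\lambda)=\{w_{D(a)}: 2\le a\le r\}$ where, for $2\le a\le r$, $D(a)$ is the diagram defined by $$D(a)=\{(i,1): 1\le i\le a-1\}\cup\{(i,2): a\le i\le r\}\cup\{(r,1),(1,2)\}.$$
   Context: Permutations. $S_n$ acts on $\{1,\dots,n\}$ on the right ($iw$ is the image of $i$ under $w$; $xy$ means first $x$, then $y$). $s_i=(i,i+1)$ and $l$ is the Coxeter length with respect to the $s_i$. An element $x$ is a prefix of $y$ if $l(y)=l(x)+l(x^{-1}y)$. Right cells. The row-form of $w\in S_n$ is $[1w,2w,\dots,nw]$; $\mathcal P(w),\mathcal Q(w)$ are the insertion and recording tableaux obtained by Robinson–Schensted row insertion of the row-form. $\sim_R$ denotes the Kazhdan–Lusztig right cell equivalence; in $S_n$, $x\sim_R y$ if and only if $\mathcal Q(x)=\mathcal Q(y)$ (known theorem, may be taken as the definition). For $\lambda=(\lambda_1,\dots,\lambda_r)$ a composition of $n$: $J(\lambda)=\{s_1,\dots,s_{n-1}\}\setminus\{s_{\lambda_1},s_{\lambda_1+\lambda_2},\dots,s_{\lambda_1+\dots+\lambda_{r-1}}\}$; $w_{J(\lambda)}$ is the longest element of the parabolic subgroup $W_{J(\lambda)}=\langle J(\lambda)\rangle$; $\mathfrak X_{J(\lambda)}$ is the set of minimum length representatives of the right cosets of $W_{J(\lambda)}$ in $S_n$. Define $Z(\lambda)=\{e\in\mathfrak X_{J(\lambda)}: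 w_{J(\lambda)}e\sim_R w_{J(\lambda)}\}$ and $Y(\lambda)=\{x\in Z(\lambda): x$ is not a prefix of any other $y\in Z(\lambda)\}$. A diagram $D$ is a finite set of nodes $(a,b)\in\mathbb Z^2$ (row $a$, column $b$; rows run top to bottom, columns left to right). For $D$ with $n$ nodes, $t^D$ and $t_D$ are the bijections $D\to\{1,\dots,n\}$ obtained by filling in $1,\dots,n$ row by row (top to bottom, left to right) and column by column (left to right, top to bottom), respectively, and $w_D\in S_n$ is defined by $t^Dw_D=t_D$. *)

theory Defs
  imports "HOL-Combinatorics.Permutations" "HOL-Algebra.Generated_Groups"
begin

section \<open>The symmetric group acting on the right\<close>

text \<open>Permutations act on the right on \<open>{1..n}\<close>: the image of \<open>i\<close> under \<open>w\<close> is \<open>w i\<close>, and the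
  product of \<open>x\<close> and \<open>y\<close> means first \<open>x\<close>, then \<open>y\<close>.  Hence this is the opposite of the group
  \<open>sym_group n\<close> from HOL-Algebra, and left and right cosets are interchanged with respect to it.\<close>

definition rsym :: "nat \<Rightarrow> (nat \<Rightarrow> nat) monoid" where
  "rsym n = \<lparr>carrier = {p. p permutes {1..n}}, mult = (\<lambda>x y. y \<circ> x), one = id\<rparr>"

lemma group_rsym: "group (rsym n)"
proof (rule groupI)
  fix x assume "x \<in> carrier (rsym n)"
  then have "inv_into UNIV x \<in> carrier (rsym n)" "x \<circ> inv_into UNIV x = id"
    by (auto simp: rsym_def permutes_inv dest: permutes_inv_o(1))
  then show "\<exists>y\<in>carrier (rsym n). y \<otimes>\<^bsub>rsym n\<^esub> x = \<one>\<^bsub>rsym n\<^esub>"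
    by (intro bexI[of _ "inv_into UNIV x"]) (auto simp: rsym_def)
qed (auto simp: rsym_def permutes_compose permutes_id comp_assoc)

definition simple_transp :: "nat \<Rightarrow> nat \<Rightarrow> nat" where
  "simple_transp i = transpose i (Suc i)"

definition simple_transps :: "nat \<Rightarrow> (nat \<Rightarrow> nat) set" where
  "simple_transps n = simple_transp ` {1..<n}"

definition cox_length :: "nat \<Rightarrow> (nat \<Rightarrow> nat) \<Rightarrow> nat" where
  "cox_length n w = (LEAST k. \<exists>ss. length ss = k \<and> set ss \<subseteq> simple_transps n \<and>
     w = foldr (\<otimes>\<^bsub>rsym n\<^esub>) ss \<one>\<^bsub>rsym n\<^esub>)"

definition cox_prefix :: "nat \<Rightarrow> (nat \<Rightarrow> nat) \<Rightarrow> (nat \<Rightarrow> nat) \<Rightarrow> bool" where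
  "cox_prefix n x y \<longleftrightarrow>
     cox_length n y = cox_length n x + cox_length n (inv\<^bsub>rsym n\<^esub> x \<otimes>\<^bsub>rsym n\<^esub> y)"

section \<open>Robinson--Schensted row insertion and right cells\<close>

text \<open>A tableau is the list of its rows, from top to bottom.  Inserting \<open>x\<close> into a row replaces the
  leftmost entry greater than \<open>x\<close>, which is bumped out; if there is none, \<open>x\<close> is appended.\<close>

fun row_insert :: "nat \<Rightarrow> nat list \<Rightarrow> nat list \<times> nat option" where
  "row_insert x [] = ([x], None)"
| "row_insert x (y # ys) =
     (if x < y then (x # ys, Some y)
      else (let (zs, b) = row_insert x ys in (y # zs, b)))"

text \<open>The second component of the result is the index (from 0) of the row that has grown.\<close>

fun tableau_insert :: "nat \<Rightarrow> nat list list \<Rightarrow> nat list list \<times> nat" where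
  "tableau_insert x [] = ([[x]], 0)"
| "tableau_insert x (row # t) =
     (case row_insert x row of
        (row', None) \<Rightarrow> (row' # t, 0)
      | (row', Some y) \<Rightarrow> (let (t', i) = tableau_insert y t in (row' # t', Suc i)))"

definition append_to_row :: "nat \<Rightarrow> nat \<Rightarrow> nat list list \<Rightarrow> nat list list" where
  "append_to_row k i t = (if i < length t then t[i := t ! i @ [k]] else t @ [[k]])"

fun rs_step :: "nat list list \<times> nat list list \<Rightarrow> nat \<times> nat \<Rightarrow> nat list list \<times> nat list list" where
  "rs_step (P, Q) (k, x) = (let (P', i) = tableau_insert x P in (P', append_to_row k i Q))"

definition robinson_schensted :: "nat list \<Rightarrow> nat list list \<times> nat list list" where
  "robinson_schensted xs = foldl rs_step ([], []) (List.enumerate 1 xs)"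

definition row_form :: "nat \<Rightarrow> (nat \<Rightarrow> nat) \<Rightarrow> nat list" where
  "row_form n w = map w [1..<Suc n]"

definition insertion_tableau :: "nat \<Rightarrow> (nat \<Rightarrow> nat) \<Rightarrow> nat list list" where
  "insertion_tableau n w = fst (robinson_schensted (row_form n w))"

definition recording_tableau :: "nat \<Rightarrow> (nat \<Rightarrow> nat) \<Rightarrow> nat list list" where
  "recording_tableau n w = snd (robinson_schensted (row_form n w))"

text \<open>In \<open>S\<^sub>n\<close> the Kazhdan--Lusztig right cells are the classes of equal recording tableau (for the
  right action); this is taken as the definition.\<close>

definition right_cell_equiv :: "nat \<Rightarrow> (nat \<Rightarrow> nat) \<Rightarrow> (nat \<Rightarrow> nat) \<Rightarrow> bool" where
  "right_cell_equiv n x y \<longleftrightarrow> recording_tableau n x = recording_tableau n y"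

section \<open>Parabolic subgroups of compositions, and the sets \<open>Z\<close> and \<open>Y\<close>\<close>

text \<open>A composition \<open>\<lambda>\<close> is a list of positive numbers; throughout \<open>n\<close> is \<open>sum_list \<lambda>\<close>.\<close>

definition comp_gens :: "nat list \<Rightarrow> (nat \<Rightarrow> nat) set" where
  "comp_gens lam = simple_transps (sum_list lam)
     - {simple_transp (sum_list (take k lam)) | k. 1 \<le> k \<and> k < length lam}"

definition parabolic :: "nat \<Rightarrow> (nat \<Rightarrow> nat) set \<Rightarrow> (nat \<Rightarrow> nat) set" where
  "parabolic n J = generate (rsym n) J"

definition longest_elt :: "nat \<Rightarrow> (nat \<Rightarrow> nat) set \<Rightarrow> (nat \<Rightarrow> nat)" where
  "longest_elt n J = (THE w. w \<in> parabolic n J \<and>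
     (\<forall>u\<in>parabolic n J. cox_length n u \<le> cox_length n w))"

definition min_coset_reps :: "nat \<Rightarrow> (nat \<Rightarrow> nat) set \<Rightarrow> (nat \<Rightarrow> nat) set" where
  "min_coset_reps n J = {e. \<exists>C\<in>rcosets\<^bsub>rsym n\<^esub> (parabolic n J).
     e \<in> C \<and> (\<forall>x\<in>C. cox_length n e \<le> cox_length n x)}"

definition Z_set :: "nat list \<Rightarrow> (nat \<Rightarrow> nat) set" where
  "Z_set lam = (let n = sum_list lam; w = longest_elt n (comp_gens lam) in
     {e \<in> min_coset_reps n (comp_gens lam). right_cell_equiv n (w \<otimes>\<^bsub>rsym n\<^esub> e) w})"

definition Y_set :: "nat list \<Rightarrow> (nat \<Rightarrow> nat) set" where
  "Y_set lam = {x \<in> Z_set lam.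
     \<not> (\<exists>y\<in>Z_set lam. y \<noteq> x \<and> cox_prefix (sum_list lam) x y)}"

section \<open>Diagrams\<close>

text \<open>The node \<open>(a, b)\<close> is in row \<open>a\<close> and column \<open>b\<close>.  The entry at a node \<open>d\<close> of the filling by rows
  is the position of \<open>d\<close> (counted from 1) in the row reading order of \<open>D\<close>; similarly for columns.\<close>

type_synonym diagram = "(int \<times> int) set"

definition row_filling :: "diagram \<Rightarrow> int \<times> int \<Rightarrow> nat" where
  "row_filling D d = card {e \<in> D. fst e < fst d \<or> (fst e = fst d \<and> snd e \<le> snd d)}"

definition col_filling :: "diagram \<Rightarrow> int \<times> int \<Rightarrow> nat" where
  "col_filling D d = card {e \<in> D. snd e < snd d \<or> (snd e = snd d \<and> fst e \<le> fst d)}"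

definition diagram_perm :: "diagram \<Rightarrow> nat \<Rightarrow> nat" where
  "diagram_perm D = (THE w. w \<in> carrier (rsym (card D)) \<and>
     (\<forall>d\<in>D. w (row_filling D d) = col_filling D d))"

definition D_diag :: "nat \<Rightarrow> nat \<Rightarrow> diagram" where
  "D_diag r a = {(i, 1) | i. 1 \<le> i \<and> i \<le> int a - 1} \<union> {(i, 2) | i. int a \<le> i \<and> i \<le> int r}
     \<union> {(int r, 1), (1, 2)}"

end

theory Submission
  imports Defs
begin

text \<open>The Coxeter length counts inversions, and \<open>x\<close> is a prefix of \<open>y\<close> iff every inversion of \<open>x\<close>
  (as a pair of positions) is one of \<open>y\<close>.  For \<open>\<lambda> = (2,1,\<dots>,1,2)\<close> the Robinson--Schensted algorithm
  shows that \<open>e\<close> lies in \<open>Z(\<lambda>)\<close> iff \<open>e\<close> increases along the positions \<open>1, 3, \<dots>, r, r+2\<close>, the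
  entries at \<open>2\<close> and \<open>r+1\<close> exceed the first and are below the last of these, and every entry of
  this chain above \<open>e(r+1)\<close> is also above \<open>e(2)\<close>.  With \<open>a = min(e(2), e(r+1))\<close> all inversions of
  \<open>e\<close> are then inversions of \<open>w\<^bsub>D(a)\<^esub>\<close>, and the inversion sets of the \<open>w\<^bsub>D(a)\<^esub>\<close> are pairwise
  incomparable.\<close>

section \<open>Inversions and Coxeter length\<close>

lemma carrier_rsym [simp]: "carrier (rsym n) = {p. p permutes {1..n}}"
  and mult_rsym [simp]: "x \<otimes>\<^bsub>rsym n\<^esub> y = y \<circ> x"
  and one_rsym [simp]: "\<one>\<^bsub>rsym n\<^esub> = id"
  by (simp_all add: rsym_def)

lemma inv_rsym:
  assumes "x permutes {1..n}"
  shows "inv\<^bsub>rsym n\<^esub> x = inv_into UNIV x"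
  by (rule group.inv_equality[OF group_rsym])
     (use assms in \<open>auto simp: permutes_inv permutes_inv_o\<close>)

definition inversions :: "nat \<Rightarrow> (nat \<Rightarrow> nat) \<Rightarrow> (nat \<times> nat) set" where
  "inversions n w = {(p, q). 1 \<le> p \<and> p < q \<and> q \<le> n \<and> w q < w p}"

lemma finite_inversions [simp]: "finite (inversions n w)"
  by (rule finite_subset[of _ "{1..n} \<times> {1..n}"]) (auto simp: inversions_def)

lemma inversions_id [simp]: "inversions n id = {}"
  by (auto simp: inversions_def)

text \<open>The pair of positions \<open>p < q\<close> gives, through \<open>x\<close>, an inversion of \<open>y \<circ> x\<inverse>\<close> exactly when
  \<open>x\<close> and \<open>y\<close> order the two positions differently.\<close>

lemma card_inversions_quotient:
  assumes x: "x permutes {1..n}" and y: "y permutes {1..n}"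
  shows "card (inversions n (y \<circ> inv_into UNIV x)) =
         card (sym_diff (inversions n x) (inversions n y))"
proof -
  let ?x' = "inv_into UNIV x"
  define D where "D = sym_diff (inversions n x) (inversions n y)"
  \<comment> \<open>\<open>f z\<close> applies \<open>z\<close> to both positions and puts the
    result in increasing order. On pairs \<open>p < q\<close> the sorting loses nothing, so
    \<open>f ?x'\<close> inverts \<open>f x\<close>.\<close>
  define f :: "(nat \<Rightarrow> nat) \<Rightarrow> nat \<times> nat \<Rightarrow> nat \<times> nat"
    where "f z = (\<lambda>(p, q). if z p < z q then (z p, z q) else (z q, z p))" for z
  have x': "?x' permutes {1..n}" using x by (rule permutes_inv)
  have [simp]: "?x' (x p) = p" "x (?x' p) = p" for p
    using permutes_inverses[OF x] by auto
  have range: "1 \<le> z p \<and> z p \<le> n" if "z permutes {1..n}" "1 \<le> p" "p \<le> n" for z p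
    using permutes_in_image[OF that(1), of p] that(2,3) by auto
  have neq: "z p \<noteq> z q" if "z permutes {1..n}" "p < q" for z p q
    using permutes_inj[OF that(1)] that(2) by (metis injD less_irrefl)
  have mem_D: "(p, q) \<in> D \<longleftrightarrow> 1 \<le> p \<and> p < q \<and> q \<le> n \<and> (x p < x q \<longleftrightarrow> y q < y p)" for p q
    using neq[OF x, of p q] neq[OF y, of p q] by (auto simp: D_def inversions_def)
  have mem_inv: "(p, q) \<in> inversions n (y \<circ> ?x') \<longleftrightarrow>
      1 \<le> p \<and> p < q \<and> q \<le> n \<and> y (?x' q) < y (?x' p)" for p q
    by (auto simp: inversions_def)
  have "bij_betw (f x) D (inversions n (y \<circ> ?x'))"
  proof (rule bij_betw_byWitness[where f' = "f ?x'"])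
    have "f ?x' (f x (p, q)) = (p, q)" "f x (f ?x' (p, q)) = (p, q)" if "p < q" for p q
      using that by (simp_all add: f_def)
    then show "\<forall>a\<in>D. f ?x' (f x a) = a"
      "\<forall>a\<in>inversions n (y \<circ> ?x'). f x (f ?x' a) = a"
      by (auto simp: D_def inversions_def)
    show "f x ` D \<subseteq> inversions n (y \<circ> ?x')"
    proof (rule image_subsetI, clarify del: UnE)
      fix p q assume "(p, q) \<in> D"
      then have "1 \<le> p" "p < q" "q \<le> n" "x p < x q \<longleftrightarrow> y q < y p" unfolding mem_D by auto
      then show "f x (p, q) \<in> inversions n (y \<circ> ?x')"
        using range[OF x, of p] range[OF x, of q] neq[OF x, of p q] neq[OF y, of p q]
        by (cases "x p < x q") (simp_all add: f_def mem_inv)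
    qed
    show "f ?x' ` inversions n (y \<circ> ?x') \<subseteq> D"
    proof (rule image_subsetI, clarify del: UnE)
      fix p q assume "(p, q) \<in> inversions n (y \<circ> ?x')"
      then have "1 \<le> p" "p < q" "q \<le> n" "y (?x' q) < y (?x' p)" unfolding mem_inv by auto
      then show "f ?x' (p, q) \<in> D"
        using range[OF x', of p] range[OF x', of q] neq[OF x', of p q]
        by (cases "?x' p < ?x' q") (simp_all add: f_def mem_D)
    qed
  qed
  then show ?thesis by (simp add: D_def bij_betw_same_card)
qed

text \<open>The ascents give \<open>i \<le> w i\<close> throughout by induction, and only the
  identity permutation has this property.\<close>

lemma permutes_eq_id_if_ascending:
  assumes w: "w permutes {1..n}" and asc: "\<And>i. 1 \<le> i \<Longrightarrow> i < n \<Longrightarrow> w i < w (Suc i)"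
  shows "w = id"
proof -
  have "i \<le> n \<longrightarrow> i \<le> w i" if "1 \<le> i" for i
    using that
  proof (induction i rule: dec_induct)
    case base
    show ?case using permutes_in_image[OF w, of 1] by auto
  next
    case (step i)
    then show ?case using asc[of i] by auto
  qed
  then have "\<forall>i\<in>{1..n}. i \<le> w i" by auto
  then show ?thesis using permutes_natset_ge[OF w] by simp
qed

lemma inversions_eq_empty_iff:
  assumes "w permutes {1..n}"
  shows "inversions n w = {} \<longleftrightarrow> w = id"
proof
  assume empty: "inversions n w = {}"
  have "w i < w (Suc i)" if "1 \<le> i" "i < n" for i
  proof -
    have "(i, Suc i) \<notin> inversions n w" using empty by simp
    then have "w i \<le> w (Suc i)" using that by (auto simp: inversions_def)
    moreover have "w i \<noteq> w (Suc i)" using permutes_inj[OF assms] by (simp add: inj_eq)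
    ultimately show ?thesis by simp
  qed
  then show "w = id" by (rule permutes_eq_id_if_ascending[OF assms])
qed (simp only: inversions_id)

text \<open>If the inversion sets agree, the quotient of the two permutations has no inversion and
  is therefore the identity.\<close>

lemma inversions_inject:
  assumes "x permutes {1..n}" "y permutes {1..n}" "inversions n x = inversions n y"
  shows "x = y"
proof -
  let ?z = "y \<circ> inv_into UNIV x"
  have z: "?z permutes {1..n}" using assms by (intro permutes_compose permutes_inv)
  have "card (inversions n ?z) = 0"
    unfolding card_inversions_quotient[OF assms(1,2)] assms(3) by simp
  then have "?z = id" using inversions_eq_empty_iff[OF z] by simp
  then have "?z \<circ> x = x" by (simp only: id_comp)
  then show ?thesis by (simp only: comp_assoc permutes_inv_o(2)[OF assms(1)] comp_id)
qed

section \<open>Simple transpositions and the length function\<close>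

lemma simple_transp_permutes:
  assumes "1 \<le> i" "i < n"
  shows "simple_transp i permutes {1..n}"
  using assms unfolding simple_transp_def by (intro permutes_swap_id) auto

lemma inversions_simple_transp:
  assumes "1 \<le> i" "i < n"
  shows "inversions n (simple_transp i) = {(i, Suc i)}"
proof (intro equalityI subsetI; clarify)
  fix p q assume "(p, q) \<in> inversions n (simple_transp i)"
  then have "p < q" "simple_transp i q < simple_transp i p" by (auto simp: inversions_def)
  then show "p = i \<and> q = Suc i"
    by (cases "p = i"; cases "p = Suc i"; cases "q = i"; cases "q = Suc i")
       (simp_all add: simple_transp_def)
next
  show "(i, Suc i) \<in> inversions n (simple_transp i)"
    using assms by (simp add: inversions_def simple_transp_def)
qed

lemma simple_transp_comp_self [simp]: "simple_transp i \<circ> simple_transp i = id"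
  by (simp add: simple_transp_def)

text \<open>A simple transposition is its own inverse and has the single inversion
  \<open>(i, Suc i)\<close>, so the symmetric difference in \<open>card_inversions_quotient\<close>
  toggles just this pair.\<close>

lemma card_inversions_simple_transp:
  assumes w: "w permutes {1..n}" and i: "1 \<le> i" "i < n"
  shows "w i < w (Suc i) \<Longrightarrow>
      card (inversions n (w \<circ> simple_transp i)) = Suc (card (inversions n w))"
    and "w (Suc i) < w i \<Longrightarrow>
      Suc (card (inversions n (w \<circ> simple_transp i))) = card (inversions n w)"
proof -
  have "inv_into UNIV (simple_transp i) = simple_transp i"
    by (simp add: simple_transp_def)
  then have card: "card (inversions n (w \<circ> simple_transp i)) =
      card (sym_diff {(i, Suc i)} (inversions n w))"
    using card_inversions_quotient[OF simple_transp_permutes[OF i] w]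
    by (simp add: inversions_simple_transp[OF i])
  have mem: "(i, Suc i) \<in> inversions n w \<longleftrightarrow> w (Suc i) < w i"
    using i by (auto simp: inversions_def)
  show "card (inversions n (w \<circ> simple_transp i)) = Suc (card (inversions n w))"
    if "w i < w (Suc i)"
  proof -
    have "sym_diff {(i, Suc i)} (inversions n w) = insert (i, Suc i) (inversions n w)"
      using that mem by auto
    then show ?thesis using that mem by (simp add: card)
  qed
  show "Suc (card (inversions n (w \<circ> simple_transp i))) = card (inversions n w)"
    if "w (Suc i) < w i"
  proof -
    have "sym_diff {(i, Suc i)} (inversions n w) = inversions n w - {(i, Suc i)}"
      using that mem by auto
    then show ?thesis using that mem by (simp add: card card_Suc_Diff1 del: card_Diff_insert)
  qed
qed

text \<open>This is the product inside \<open>cox_length\<close>. As the product is reversed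
  composition, a letter put in front is composed on the right and swaps the entries at two
  neighbouring positions.\<close>

definition word_perm :: "nat \<Rightarrow> (nat \<Rightarrow> nat) list \<Rightarrow> nat \<Rightarrow> nat" where
  "word_perm n ss = foldr (\<otimes>\<^bsub>rsym n\<^esub>) ss \<one>\<^bsub>rsym n\<^esub>"

lemma word_perm_Nil: "word_perm n [] = id"
  by (simp only: word_perm_def foldr.simps id_apply one_rsym)

lemma word_perm_Cons: "word_perm n (s # ss) = word_perm n ss \<circ> s"
  by (simp only: word_perm_def foldr.simps comp_apply mult_rsym)

lemma card_inversions_word_perm_le:
  assumes "set ss \<subseteq> simple_transps n"
  shows "word_perm n ss permutes {1..n} \<and> card (inversions n (word_perm n ss)) \<le> length ss"
  using assms
proof (induction ss)
  case Nil
  show ?case by (simp only: word_perm_Nil inversions_id permutes_id) simp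
next
  case (Cons s ss)
  then obtain i where i: "s = simple_transp i" "1 \<le> i" "i < n"
    by (auto simp: simple_transps_def)
  let ?w = "word_perm n ss"
  have w: "?w permutes {1..n}" "card (inversions n ?w) \<le> length ss"
    using Cons.IH Cons.prems by simp_all
  have "?w i \<noteq> ?w (Suc i)" using permutes_inj[OF w(1)] by (simp add: inj_eq)
  then consider "?w i < ?w (Suc i)" | "?w (Suc i) < ?w i" by linarith
  then have "card (inversions n (?w \<circ> s)) \<le> Suc (length ss)"
    unfolding i(1) using card_inversions_simple_transp[OF w(1) i(2,3)] w(2) by cases linarith+
  moreover have "?w \<circ> s permutes {1..n}"
    unfolding i(1) using simple_transp_permutes[OF i(2,3)] w(1) by (rule permutes_compose)
  ultimately show ?case by (simp only: word_perm_Cons length_Cons)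
qed

text \<open>Sorting by adjacent swaps: a permutation other than the identity has a descent, and
  swapping there removes exactly one inversion.\<close>

lemma word_of_length_card_inversions:
  assumes "w permutes {1..n}"
  shows "\<exists>ss. length ss = card (inversions n w) \<and> set ss \<subseteq> simple_transps n \<and> w = word_perm n ss"
  using assms
proof (induction "card (inversions n w)" arbitrary: w)
  case 0
  then have "w = id" using inversions_eq_empty_iff[of w n] by simp
  then show ?case by (intro exI[of _ "[]"]) (simp only: word_perm_Nil inversions_id, simp)
next
  case (Suc k)
  from Suc.hyps(2) have "w \<noteq> id" by auto
  then obtain i where i: "1 \<le> i" "i < n" "\<not> w i < w (Suc i)"
    using permutes_eq_id_if_ascending[OF Suc.prems] by blast
  have "w i \<noteq> w (Suc i)" using permutes_inj[OF Suc.prems] by (simp add: inj_eq)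
  then have "w (Suc i) < w i" using i(3) by linarith
  then have k: "k = card (inversions n (w \<circ> simple_transp i))"
    using card_inversions_simple_transp(2)[OF Suc.prems i(1,2)] Suc.hyps(2) by simp
  from Suc.hyps(1)[OF k permutes_compose[OF simple_transp_permutes[OF i(1,2)] Suc.prems]]
  obtain ss where ss: "length ss = k" "set ss \<subseteq> simple_transps n"
    "w \<circ> simple_transp i = word_perm n ss"
    unfolding k[symmetric] by blast
  have "w = (w \<circ> simple_transp i) \<circ> simple_transp i"
    by (simp only: comp_assoc simple_transp_comp_self comp_id)
  then have "w = word_perm n (simple_transp i # ss)"
    by (simp only: ss(3) word_perm_Cons)
  moreover have "simple_transp i \<in> simple_transps n" using i by (simp add: simple_transps_def)
  ultimately show ?case
    using ss(1,2) Suc.hyps(2) by (intro exI[of _ "simple_transp i # ss"]) simp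
qed

lemma cox_length_eq_card_inversions:
  assumes "w permutes {1..n}"
  shows "cox_length n w = card (inversions n w)"
  unfolding cox_length_def word_perm_def[symmetric]
proof (rule Least_equality)
  show "\<exists>ss. length ss = card (inversions n w) \<and> set ss \<subseteq> simple_transps n \<and> w = word_perm n ss"
    by (rule word_of_length_card_inversions[OF assms])
  show "card (inversions n w) \<le> k"
    if "\<exists>ss. length ss = k \<and> set ss \<subseteq> simple_transps n \<and> w = word_perm n ss" for k
    using that card_inversions_word_perm_le by blast
qed

text \<open>With \<open>X\<close>, \<open>Y\<close> the inversion sets, the length condition reads
  \<open>|Y| = |X| + |X - Y| + |Y - X|\<close>. Splitting off the intersection leaves
  \<open>|X - Y| = 0\<close>.\<close>

lemma cox_prefix_iff_inversions_subset:
  assumes x: "x permutes {1..n}" and y: "y permutes {1..n}"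
  shows "cox_prefix n x y \<longleftrightarrow> inversions n x \<subseteq> inversions n y"
proof -
  let ?X = "inversions n x" and ?Y = "inversions n y"
  have z: "y \<circ> inv_into UNIV x permutes {1..n}"
    using x y by (intro permutes_compose permutes_inv)
  have "cox_prefix n x y \<longleftrightarrow> card ?Y = card ?X + card (sym_diff ?X ?Y)"
    by (simp add: cox_prefix_def inv_rsym[OF x] cox_length_eq_card_inversions x y z
        card_inversions_quotient del: One_nat_def)
  moreover have "card (sym_diff ?X ?Y) = card (?X - ?Y) + card (?Y - ?X)"
    by (rule card_Un_disjoint) auto
  moreover have "card ?X = card (?X \<inter> ?Y) + card (?X - ?Y)"
    by (rule card_Int_Diff) simp
  moreover have "card ?Y = card (?X \<inter> ?Y) + card (?Y - ?X)"
    using card_Int_Diff[of ?Y ?X] by (simp add: Int_commute)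
  ultimately have "cox_prefix n x y \<longleftrightarrow> card (?X - ?Y) = 0" by linarith
  then show ?thesis by auto
qed

section \<open>Minimal coset representatives\<close>

text \<open>A coset that contains \<open>e\<close> is the coset of \<open>e\<close>, and its
  elements, the products of some \<open>p\<close> in the parabolic subgroup with \<open>e\<close>,
  are the functions \<open>e \<circ> p\<close>.\<close>

lemma min_coset_reps_iff:
  assumes "J \<subseteq> carrier (rsym n)"
  shows "e \<in> min_coset_reps n J \<longleftrightarrow> e permutes {1..n} \<and>
    (\<forall>p\<in>parabolic n J. cox_length n e \<le> cox_length n (e \<circ> p))"
proof -
  interpret group "rsym n" by (rule group_rsym)
  have P: "subgroup (parabolic n J) (rsym n)"
    unfolding parabolic_def using assms by (rule generate_is_subgroup)
  have coset: "x \<in> parabolic n J #>\<^bsub>rsym n\<^esub> e \<longleftrightarrow> (\<exists>p\<in>parabolic n J. x = e \<circ> p)" for x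
    by (auto simp: r_coset_def)
  show ?thesis
  proof
    assume "e \<in> min_coset_reps n J"
    then obtain a where a: "a \<in> carrier (rsym n)" "e \<in> parabolic n J #>\<^bsub>rsym n\<^esub> a"
      and min: "\<forall>x\<in>parabolic n J #>\<^bsub>rsym n\<^esub> a. cox_length n e \<le> cox_length n x"
      by (auto simp: min_coset_reps_def RCOSETS_def)
    have "parabolic n J #>\<^bsub>rsym n\<^esub> e = parabolic n J #>\<^bsub>rsym n\<^esub> a"
      using repr_independence[OF a(2,1) P] by simp
    then have "cox_length n e \<le> cox_length n (e \<circ> p)" if "p \<in> parabolic n J" for p
      using min that coset by metis
    moreover have "e \<in> carrier (rsym n)"
      using r_coset_subset_G[OF subgroup.subset[OF P] a(1)] a(2) by blast
    ultimately show "e permutes {1..n} \<and>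
      (\<forall>p\<in>parabolic n J. cox_length n e \<le> cox_length n (e \<circ> p))"
      by simp
  next
    assume e: "e permutes {1..n} \<and>
      (\<forall>p\<in>parabolic n J. cox_length n e \<le> cox_length n (e \<circ> p))"
    then have "parabolic n J #>\<^bsub>rsym n\<^esub> e \<in> rcosets\<^bsub>rsym n\<^esub> (parabolic n J)"
      unfolding RCOSETS_def by simp blast
    moreover have "e \<in> parabolic n J #>\<^bsub>rsym n\<^esub> e"
      using rcos_self[OF _ P] e by simp
    moreover have "\<forall>x\<in>parabolic n J #>\<^bsub>rsym n\<^esub> e. cox_length n e \<le> cox_length n x"
      using e coset by metis
    ultimately show "e \<in> min_coset_reps n J"
      unfolding min_coset_reps_def by blast
  qed
qed

text \<open>Every product reduces to a power of \<open>a\<close> times a power of \<open>b\<close>.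
  The variants of the relations with a trailing factor \<open>c\<close> allow this under association
  to the right.\<close>

lemma (in group) generate_commuting_involutions:
  assumes [simp]: "a \<in> carrier G" "b \<in> carrier G"
    and aa: "a \<otimes> a = \<one>" and bb: "b \<otimes> b = \<one>" and ab: "b \<otimes> a = a \<otimes> b"
  shows "generate G {a, b} = {\<one>, a, b, a \<otimes> b}"
proof
  have aa': "a \<otimes> (a \<otimes> c) = c" and bb': "b \<otimes> (b \<otimes> c) = c" and ab': "b \<otimes> (a \<otimes> c) = a \<otimes> (b \<otimes> c)"
    if "c \<in> carrier G" for c
    using that aa bb ab by (simp_all flip: m_assoc)
  have inv: "inv a = a" "inv b = b" using aa bb by (auto intro: inv_equality)
  show "generate G {a, b} \<subseteq> {\<one>, a, b, a \<otimes> b}"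
  proof
    fix x assume "x \<in> generate G {a, b}"
    then show "x \<in> {\<one>, a, b, a \<otimes> b}"
    proof induction
      case (eng x y)
      then show ?case by (auto simp: m_assoc aa bb ab aa' bb' ab')
    qed (auto simp: inv)
  qed
  show "{\<one>, a, b, a \<otimes> b} \<subseteq> generate G {a, b}"
    by (auto intro: generate.intros)
qed

section \<open>The recording tableau\<close>

lemma snd_row_insert: "snd (row_insert x row) = find (\<lambda>y. x < y) row"
  by (induction row) (auto split: prod.splits)

lemma row_insert_append:
  "\<forall>y\<in>set row. y \<le> x \<Longrightarrow> row_insert x row = (row @ [x], None)"
  by (induction row) auto

lemma rs_step_append:
  "\<forall>y\<in>set row. y \<le> x \<Longrightarrow>
    rs_step (row # P, q # Q) (k, x) = ((row @ [x]) # P, (q @ [k]) # Q)"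
  by (simp add: row_insert_append append_to_row_def)

text \<open>A bumped entry goes on to the rows below, so the new label lands there too and the first
  recording row stays as it is.\<close>

lemma rs_step_bump:
  assumes "\<not> (\<forall>y\<in>set row. y \<le> x)"
  obtains row' P' Q' where "rs_step (row # P, q # Q) (k, x) = (row' # P', q # Q')"
proof -
  have "snd (row_insert x row) \<noteq> None"
    using assms by (auto simp: snd_row_insert find_None_iff)
  then obtain row' y where "row_insert x row = (row', Some y)" by (metis option.exhaust prod.collapse)
  moreover obtain P' i where "tableau_insert y P = (P', i)" by (metis prod.exhaust)
  ultimately show ?thesis
    using that[of row' P' "tl (append_to_row k (Suc i) (q # Q))"]
    by (simp add: append_to_row_def)
qed

lemma foldl_rs_step_sorted:
  "sorted (row @ map snd kxs) \<Longrightarrow>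
    foldl rs_step (row # P, q # Q) kxs = ((row @ map snd kxs) # P, (q @ map fst kxs) # Q)"
proof (induction kxs arbitrary: row q)
  case (Cons kx kxs)
  then have "\<forall>y\<in>set row. y \<le> snd kx" by (auto simp: sorted_append)
  then have "rs_step (row # P, q # Q) kx = ((row @ [snd kx]) # P, (q @ [fst kx]) # Q)"
    using rs_step_append[of row "snd kx" P q Q "fst kx"] by simp
  with Cons show ?case by simp
qed simp

text \<open>The first recording row grows only when a letter is appended to the first row without a
  bump. Maximal growth thus means that no letter bumped, which for a sorted start forces the whole
  word to be sorted.\<close>

lemma foldl_rs_step_first_row:
  "\<exists>P' q' Q'. foldl rs_step (row # P, q # Q) kxs = (P', q' # Q') \<and>
    length q' \<le> length q + length kxs \<and>
    (sorted row \<longrightarrow> length q' = length q + length kxs \<longrightarrow> sorted (row @ map snd kxs))"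
proof (induction kxs arbitrary: row P q Q)
  case (Cons kx kxs)
  show ?case
  proof (cases "\<forall>y\<in>set row. y \<le> snd kx")
    case True
    then have step: "rs_step (row # P, q # Q) kx = ((row @ [snd kx]) # P, (q @ [fst kx]) # Q)"
      using rs_step_append[of row "snd kx" P q Q "fst kx"] by simp
    from True have "sorted row \<longrightarrow> sorted (row @ [snd kx])" by (auto simp: sorted_append)
    with Cons.IH[of "row @ [snd kx]" P "q @ [fst kx]" Q] show ?thesis
      by (auto simp: step)
  next
    case False
    then obtain row' P' Q' where step: "rs_step (row # P, q # Q) kx = (row' # P', q # Q')"
      using rs_step_bump[of row "snd kx" P q Q "fst kx"] by auto
    from Cons.IH[of row' P' q Q'] show ?thesis by (auto simp: step)
  qed
qed auto

text \<open>The letter \<open>x1\<close> bumps \<open>x2\<close> into the second row. The prescribed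
  tableau then says that all of \<open>cs\<close> is appended to the first row and that the entry
  \<open>b\<close> bumped by \<open>y\<close> comes to rest to the right of
  \<open>x2\<close>.\<close>

lemma recording_two_rows_iff:
  assumes "x1 < x2"
  shows "snd (robinson_schensted (x2 # x1 # cs @ [y])) =
      [1 # [3..<3 + length cs], [2, 3 + length cs]] \<longleftrightarrow>
    sorted (x1 # cs) \<and> (\<exists>b. find (\<lambda>c. y < c) (x1 # cs) = Some b \<and> x2 \<le> b)"
    (is "?Q = ?T \<longleftrightarrow> _")
proof -
  \<comment> \<open>The labels start at 3, since the first two letters have built the one-column
    tableaux from which \<open>S\<close> starts.\<close>
  define kxs where "kxs = List.enumerate 3 cs"
  have kxs: "map snd kxs = cs" "map fst kxs = [3..<3 + length cs]" "length kxs = length cs"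
    by (simp_all add: kxs_def)
  define S where "S = foldl rs_step ([[x1], [x2]], [[1], [2]]) kxs"
  have Q: "?Q = snd (rs_step S (3 + length cs, y))"
    using assms
    by (simp add: robinson_schensted_def enumerate_append_eq kxs_def S_def append_to_row_def
        numeral_3_eq_3 numeral_2_eq_2)
  have sorted_case: "?Q = ?T \<longleftrightarrow> (\<exists>b. find (\<lambda>c. y < c) (x1 # cs) = Some b \<and> x2 \<le> b)"
    if "sorted (x1 # cs)"
  proof -
    have S: "S = ([x1 # cs, [x2]], [1 # [3..<3 + length cs], [2]])"
      unfolding S_def using that foldl_rs_step_sorted[of "[x1]" kxs] by (simp add: kxs)
    obtain row' b where row': "row_insert y (x1 # cs) = (row', b)" by (metis prod.exhaust)
    then have b: "find (\<lambda>c. y < c) (x1 # cs) = b" using snd_row_insert[of y "x1 # cs"] by simp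
    \<comment> \<open>Without a bump \<open>y\<close> extends the first row; a bumped
      \<open>b\<close> is placed after \<open>x2\<close> if \<open>x2 \<le> b\<close> and opens a
      third row otherwise.\<close>
    show ?thesis
      unfolding Q S b using row'
      by (cases b) (auto simp: append_to_row_def simp del: row_insert.simps find.simps upt.simps
          simp: row_insert.simps(1) row_insert.simps(2)[of _ x2])
  qed
  moreover have "sorted (x1 # cs)" if T: "?Q = ?T"
  proof -
    obtain P' q' Q' where S: "S = (P', q' # Q')" "length q' \<le> 1 + length cs"
      "length q' = 1 + length cs \<longrightarrow> sorted (x1 # cs)"
      using foldl_rs_step_first_row[of "[x1]" "[[x2]]" "[1]" "[[2]]" kxs]
      by (auto simp: S_def kxs)
    obtain P'' i where ins: "tableau_insert y P' = (P'', i)" by (metis prod.exhaust)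
    have T': "append_to_row (3 + length cs) i (q' # Q') = ?T"
      using T by (simp add: Q S(1) ins)
    \<comment> \<open>The last label stands in the second row of \<open>?T\<close>. Hence
      \<open>q'\<close> is already the full first row, and its maximal length shows that the word is
      sorted.\<close>
    have "i \<noteq> 0"
    proof
      assume "i = 0"
      then have "q' @ [3 + length cs] = 1 # [3..<3 + length cs]"
        using T' by (simp add: append_to_row_def)
      then have "3 + length cs \<in> set (1 # [3..<3 + length cs])"
        by (metis in_set_conv_decomp)
      then show False by simp
    qed
    then have "q' = 1 # [3..<3 + length cs]"
      using T' by (cases i) (auto simp: append_to_row_def split: if_splits)
    then show ?thesis using S(3) by simp
  qed
  ultimately show ?thesis by blast
qed

text \<open>In a sorted list the first entry above \<open>y\<close> is also the least one above
  \<open>y\<close>.\<close>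

lemma find_less_iff_of_sorted:
  fixes y :: nat
  assumes "sorted cs"
  shows "(\<exists>b. find (\<lambda>c. y < c) cs = Some b \<and> x \<le> b) \<longleftrightarrow>
    (\<exists>c\<in>set cs. y < c) \<and> (\<forall>c\<in>set cs. y < c \<longrightarrow> x \<le> c)"
  using assms by (induction cs) auto

lemma sorted_map_iff_strict_increasing:
  fixes f :: "nat \<Rightarrow> nat"
  assumes "sorted_wrt (<) L" "inj f"
  shows "sorted (map f L) \<longleftrightarrow> (\<forall>p\<in>set L. \<forall>q\<in>set L. p < q \<longrightarrow> f p < f q)"
  using assms(1)
proof (induction L)
  case (Cons a L)
  have "f a \<le> f q \<longleftrightarrow> f a < f q" if "q \<in> set L" for q
    using Cons.prems that inj_eq[OF assms(2), of a q] by (auto simp: order_le_less)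
  then show ?case using Cons by (fastforce dest: order.asym)
qed simp

section \<open>The composition (2,1,...,1,2)\<close>

lemma inj_simple_transp: "inj simple_transp"
proof
  fix i j assume "simple_transp i = simple_transp j"
  then have "simple_transp j i = Suc i" by (metis simple_transp_def transpose_apply_first)
  then show "i = j"
    by (cases "i = j"; cases "i = Suc j") (simp_all add: simple_transp_def)
qed

lemma sum_list_composition:
  assumes "r \<ge> 2"
  shows "sum_list ([2] @ replicate (r - 2) 1 @ [2]) = r + 2"
  using assms by (simp add: sum_list_replicate)

text \<open>The first \<open>k\<close> parts add up to \<open>k + 1\<close> for
  \<open>1 \<le> k < r\<close>, so the generators with indices 2 to \<open>r\<close> are removed.
  Injectivity of \<open>simple_transp\<close> lets the difference be taken on indices.\<close>

lemma comp_gens_composition: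
  assumes "r \<ge> 2"
  shows "comp_gens ([2] @ replicate (r - 2) 1 @ [2]) = {simple_transp 1, simple_transp (r + 1)}"
proof -
  let ?lam = "[2] @ replicate (r - 2) 1 @ [2] :: nat list"
  have partial: "sum_list (take k ?lam) = Suc k" if "1 \<le> k" "k < r" for k
  proof -
    define j where "j = k - 1"
    then have j: "k = Suc j" using that(1) by simp
    then have "take k ?lam = 2 # replicate j 1" using that(2) by (simp add: min_def)
    then show ?thesis by (simp add: sum_list_replicate j)
  qed
  have len: "length ?lam = r" using assms by simp
  have "{simple_transp (sum_list (take k ?lam)) | k. 1 \<le> k \<and> k < length ?lam} =
      simple_transp ` {2..r}"
  proof (intro equalityI subsetI)
    fix x assume "x \<in> simple_transp ` {2..r}"
    then obtain j where "x = simple_transp j" "2 \<le> j" "j \<le> r" by auto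
    then show "x \<in> {simple_transp (sum_list (take k ?lam)) | k. 1 \<le> k \<and> k < length ?lam}"
      unfolding len using partial[of "j - 1"] by (intro CollectI exI[of _ "j - 1"]) auto
  next
    fix x assume "x \<in> {simple_transp (sum_list (take k ?lam)) | k. 1 \<le> k \<and> k < length ?lam}"
    then obtain k where k: "x = simple_transp (sum_list (take k ?lam))" "1 \<le> k" "k < r"
      unfolding len by blast
    then have "x = simple_transp (Suc k)" using partial[of k] by simp
    then show "x \<in> simple_transp ` {2..r}" using k by auto
  qed
  then have "comp_gens ?lam = simple_transp ` ({1..<r + 2} - {2..r})"
    unfolding comp_gens_def simple_transps_def sum_list_composition[OF assms]
    by (simp only: image_set_diff[OF inj_simple_transp])
  also have "{1..<r + 2} - {2..r} = {1, r + 1}" using assms by auto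
  finally show ?thesis by simp
qed

text \<open>The two transpositions move the disjoint sets \<open>{1, 2}\<close> and
  \<open>{r + 1, r + 2}\<close>, so they commute.\<close>

lemma parabolic_ends:
  assumes "r \<ge> 2"
  shows "parabolic (r + 2) {simple_transp 1, simple_transp (r + 1)} =
    {id, simple_transp 1, simple_transp (r + 1), simple_transp (r + 1) \<circ> simple_transp 1}"
proof -
  let ?s = "simple_transp 1" and ?t = "simple_transp (r + 1)"
  have "(?s \<circ> ?t) k = (?t \<circ> ?s) k" for k
  proof (cases "k \<in> {1, 2}")
    case True
    then show ?thesis using assms by (auto simp: simple_transp_def transpose_def)
  next
    case False
    moreover have "?t k \<notin> {1, 2}" using False assms by (auto simp: simple_transp_def transpose_def)
    ultimately show ?thesis by (simp add: simple_transp_def transpose_def)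
  qed
  then have "?s \<circ> ?t = ?t \<circ> ?s" ..
  then show ?thesis
    unfolding parabolic_def
    using group.generate_commuting_involutions[OF group_rsym, of ?s "r + 2" ?t]
      simple_transp_permutes[of 1 "r + 2"] simple_transp_permutes[of "r + 1" "r + 2"]
    by (simp only: carrier_rsym mult_rsym one_rsym mem_Collect_eq simple_transp_comp_self)
qed

text \<open>Swapping an ascent creates one inversion. The swap at the last two positions leaves the
  entries at 1 and 2 alone, so the two contributions add up.\<close>

lemma cox_length_compose_ends:
  assumes r: "r \<ge> 3" and e: "e permutes {1..r + 2}" and asc: "e 1 < e 2" "e (r + 1) < e (r + 2)"
  shows "cox_length (r + 2) (e \<circ> simple_transp 1) = cox_length (r + 2) e + 1"
    and "cox_length (r + 2) (e \<circ> simple_transp (r + 1)) = cox_length (r + 2) e + 1"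
    and "cox_length (r + 2) (e \<circ> (simple_transp (r + 1) \<circ> simple_transp 1)) =
      cox_length (r + 2) e + 2"
proof -
  let ?n = "r + 2" and ?s = "simple_transp 1" and ?t = "simple_transp (r + 1)"
  have s: "?s permutes {1..?n}" and t: "?t permutes {1..?n}"
    using simple_transp_permutes[of 1 ?n] simple_transp_permutes[of "r + 1" ?n] by auto
  have et: "e \<circ> ?t permutes {1..?n}" using t e by (rule permutes_compose)
  have "(e \<circ> ?t) 1 < (e \<circ> ?t) (Suc 1)"
    using asc(1) r by (simp add: simple_transp_def transpose_def numeral_2_eq_2)
  then have "card (inversions ?n (e \<circ> ?t \<circ> ?s)) = Suc (card (inversions ?n (e \<circ> ?t)))"
    using card_inversions_simple_transp(1)[OF et, of 1] by simp
  moreover have "card (inversions ?n (e \<circ> ?t)) = Suc (card (inversions ?n e))"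
    using card_inversions_simple_transp(1)[OF e, of "r + 1"] asc(2) by simp
  moreover have "card (inversions ?n (e \<circ> ?s)) = Suc (card (inversions ?n e))"
    using card_inversions_simple_transp(1)[OF e, of 1] asc(1) by (simp add: numeral_2_eq_2)
  ultimately show "cox_length ?n (e \<circ> ?s) = cox_length ?n e + 1"
    "cox_length ?n (e \<circ> ?t) = cox_length ?n e + 1"
    "cox_length ?n (e \<circ> (?t \<circ> ?s)) = cox_length ?n e + 2"
    using cox_length_eq_card_inversions[OF permutes_compose[OF s e]]
      cox_length_eq_card_inversions[OF et]
      cox_length_eq_card_inversions[OF permutes_compose[OF s et]]
      cox_length_eq_card_inversions[OF e]
    by (simp_all add: comp_assoc)
qed

lemma longest_elt_ends:
  assumes r: "r \<ge> 3"
  shows "longest_elt (r + 2) {simple_transp 1, simple_transp (r + 1)} =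
    simple_transp (r + 1) \<circ> simple_transp 1"
proof -
  have P: "parabolic (r + 2) {simple_transp 1, simple_transp (r + 1)} =
    {id, simple_transp 1, simple_transp (r + 1), simple_transp (r + 1) \<circ> simple_transp 1}"
    using parabolic_ends r by simp
  show ?thesis
    unfolding longest_elt_def P
    \<comment> \<open>For \<open>e = id\<close> the four lengths are 0, 1, 1, 2, so the maximum is
      attained only once.\<close>
    using cox_length_compose_ends[OF r permutes_id]
    by (intro the_equality) auto
qed

lemma min_coset_reps_ends_iff:
  assumes r: "r \<ge> 3"
  shows "e \<in> min_coset_reps (r + 2) {simple_transp 1, simple_transp (r + 1)} \<longleftrightarrow>
    e permutes {1..r + 2} \<and> e 1 < e 2 \<and> e (r + 1) < e (r + 2)"
proof -
  let ?n = "r + 2" and ?s = "simple_transp 1" and ?t = "simple_transp (r + 1)"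
  have s: "?s permutes {1..?n}" and t: "?t permutes {1..?n}"
    using simple_transp_permutes[of 1 ?n] simple_transp_permutes[of "r + 1" ?n] by auto
  have P: "parabolic ?n {?s, ?t} = {id, ?s, ?t, ?t \<circ> ?s}" using parabolic_ends r by simp
  have iff: "e \<in> min_coset_reps ?n {?s, ?t} \<longleftrightarrow> e permutes {1..?n} \<and>
      (\<forall>p\<in>{id, ?s, ?t, ?t \<circ> ?s}. cox_length ?n e \<le> cox_length ?n (e \<circ> p))"
    unfolding P[symmetric] using s t by (intro min_coset_reps_iff) auto
  show ?thesis
  proof
    assume "e \<in> min_coset_reps ?n {?s, ?t}"
    then have e: "e permutes {1..?n}"
      and le: "cox_length ?n e \<le> cox_length ?n (e \<circ> ?s)" "cox_length ?n e \<le> cox_length ?n (e \<circ> ?t)"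
      using iff by auto
    have "card (inversions ?n e) \<le> card (inversions ?n (e \<circ> ?s))"
      "card (inversions ?n e) \<le> card (inversions ?n (e \<circ> ?t))"
      using le cox_length_eq_card_inversions[OF e]
        cox_length_eq_card_inversions[OF permutes_compose[OF s e]]
        cox_length_eq_card_inversions[OF permutes_compose[OF t e]] by simp_all
    then have "\<not> e (Suc 1) < e 1" "\<not> e (Suc (r + 1)) < e (r + 1)"
      using card_inversions_simple_transp(2)[OF e, of 1]
        card_inversions_simple_transp(2)[OF e, of "r + 1"] by auto
    moreover have "e (Suc 1) \<noteq> e 1" "e (Suc (r + 1)) \<noteq> e (r + 1)"
      using permutes_inj[OF e] by (simp_all add: inj_eq)
    ultimately have "e 1 < e (Suc 1)" "e (r + 1) < e (Suc (r + 1))" by linarith+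
    then show "e permutes {1..?n} \<and> e 1 < e 2 \<and> e (r + 1) < e (r + 2)"
      using e by (simp add: numeral_2_eq_2)
  next
    assume "e permutes {1..?n} \<and> e 1 < e 2 \<and> e (r + 1) < e (r + 2)"
    then show "e \<in> min_coset_reps ?n {?s, ?t}"
      unfolding iff using cox_length_compose_ends[OF r, of e] by auto
  qed
qed

text \<open>These are all positions but 2 and \<open>r + 1\<close>. After multiplication by the
  longest element their entries form the list \<open>x1 # cs\<close> of
  \<open>recording_two_rows_iff\<close>.\<close>

definition chain_positions :: "nat \<Rightarrow> nat set" where
  "chain_positions r = insert 1 (insert (r + 2) {3..r})"

text \<open>The longest element swaps the first two and the last two entries, so the row-form
  becomes \<open>e 2, e 1, e 3, ..., e r, e (r + 2), e (r + 1)\<close>, to which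
  \<open>recording_two_rows_iff\<close> applies.\<close>

lemma recording_tableau_longest_compose_iff:
  assumes r: "r \<ge> 3" and e: "e permutes {1..r + 2}"
    and asc: "e 1 < e 2" "e (r + 1) < e (r + 2)"
  shows "recording_tableau (r + 2) (e \<circ> (simple_transp (r + 1) \<circ> simple_transp 1)) =
      [1 # [3..<r + 2], [2, r + 2]] \<longleftrightarrow>
    (\<forall>p\<in>chain_positions r. \<forall>q\<in>chain_positions r. p < q \<longrightarrow> e p < e q) \<and>
    (\<forall>c\<in>chain_positions r. e (r + 1) < e c \<longrightarrow> e 2 < e c)"
proof -
  let ?w = "e \<circ> (simple_transp (r + 1) \<circ> simple_transp 1)"
  define L where "L = 1 # [3..<r + 1] @ [r + 2]"
  have set_L: "set L = chain_positions r" by (auto simp: L_def chain_positions_def)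
  have L: "sorted_wrt (<) L" using r by (auto simp: L_def sorted_wrt_append)
  have inj: "inj e" using permutes_inj[OF e] .
  have "[1..<Suc (r + 2)] = [1, 2] @ [3..<r + 1] @ [r + 1, r + 2]"
    using r upt_add_eq_append[of 3 "r + 1" 2] upt_conv_Cons[of 1 "r + 3"] upt_conv_Cons[of 2 "r + 3"]
    by (simp add: numeral_2_eq_2 numeral_3_eq_3)
  moreover have "map ?w [3..<r + 1] = map e [3..<r + 1]"
    by (rule map_cong) (auto simp: simple_transp_def transpose_def)
  moreover have "?w 1 = e 2" "?w 2 = e 1" "?w (r + 1) = e (r + 2)" "?w (r + 2) = e (r + 1)"
    using r by (auto simp: simple_transp_def transpose_def numeral_2_eq_2)
  ultimately have row: "row_form (r + 2) ?w =
      e 2 # e 1 # map e ([3..<r + 1] @ [r + 2]) @ [e (r + 1)]"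
    by (simp only: row_form_def map_append list.map append.simps append_assoc)
  have "recording_tableau (r + 2) ?w = [1 # [3..<r + 2], [2, r + 2]] \<longleftrightarrow>
      sorted (map e L) \<and> (\<exists>b. find (\<lambda>c. e (r + 1) < c) (map e L) = Some b \<and> e 2 \<le> b)"
    unfolding recording_tableau_def row L_def
    using recording_two_rows_iff[OF asc(1), of "map e ([3..<r + 1] @ [r + 2])" "e (r + 1)"] r
    by (simp del: upt.simps)
  also have "\<dots> \<longleftrightarrow> sorted (map e L) \<and> (\<exists>c\<in>set (map e L). e (r + 1) < c) \<and>
      (\<forall>c\<in>set (map e L). e (r + 1) < c \<longrightarrow> e 2 \<le> c)"
    using find_less_iff_of_sorted by blast
  \<comment> \<open>The entry at \<open>r + 2\<close> belongs to the chain and exceeds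
    \<open>e (r + 1)\<close>, which settles the existence clause.\<close>
  also have "\<dots> \<longleftrightarrow> sorted (map e L) \<and> (\<forall>c\<in>chain_positions r. e (r + 1) < e c \<longrightarrow> e 2 \<le> e c)"
    using asc(2) by (auto simp: set_L[symmetric] L_def)
  also have "\<dots> \<longleftrightarrow> sorted (map e L) \<and> (\<forall>c\<in>chain_positions r. e (r + 1) < e c \<longrightarrow> e 2 < e c)"
  proof -
    have "e c \<noteq> e 2" if "c \<in> chain_positions r" for c
      using that inj_eq[OF inj, of c 2] r by (auto simp: chain_positions_def)
    then show ?thesis by (metis order_le_less)
  qed
  finally show ?thesis
    unfolding sorted_map_iff_strict_increasing[OF L inj] set_L .
qed

lemma Z_set_composition_iff:
  assumes r: "r \<ge> 3"
  shows "e \<in> Z_set ([2] @ replicate (r - 2) 1 @ [2]) \<longleftrightarrow>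
    e permutes {1..r + 2} \<and> e 1 < e 2 \<and> e (r + 1) < e (r + 2) \<and>
    (\<forall>p\<in>chain_positions r. \<forall>q\<in>chain_positions r. p < q \<longrightarrow> e p < e q) \<and>
    (\<forall>c\<in>chain_positions r. e (r + 1) < e c \<longrightarrow> e 2 < e c)"
proof -
  let ?lam = "[2] @ replicate (r - 2) 1 @ [2] :: nat list"
  let ?w = "simple_transp (r + 1) \<circ> simple_transp 1"
  have lam: "sum_list ?lam = r + 2" "comp_gens ?lam = {simple_transp 1, simple_transp (r + 1)}"
    using r sum_list_composition[of r] comp_gens_composition[of r] by auto
  \<comment> \<open>The criterion for \<open>e = id\<close> yields the tableau of the longest
    element itself, without a run of the algorithm.\<close>
  have "recording_tableau (r + 2) (id \<circ> ?w) = [1 # [3..<r + 2], [2, r + 2]]"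
    by (subst recording_tableau_longest_compose_iff[OF r permutes_id])
       (use r in \<open>auto simp: chain_positions_def\<close>)
  then have Q: "right_cell_equiv (r + 2) (e \<circ> ?w) ?w \<longleftrightarrow>
      recording_tableau (r + 2) (e \<circ> ?w) = [1 # [3..<r + 2], [2, r + 2]]"
    by (simp only: right_cell_equiv_def id_comp)
  have "e \<in> Z_set ?lam \<longleftrightarrow>
      e \<in> min_coset_reps (r + 2) {simple_transp 1, simple_transp (r + 1)} \<and>
      right_cell_equiv (r + 2) (e \<circ> ?w) ?w"
    unfolding Z_set_def Let_def lam longest_elt_ends[OF r] mult_rsym by simp
  then show ?thesis
    unfolding min_coset_reps_ends_iff[OF r] Q
    using recording_tableau_longest_compose_iff[OF r, of e] by blast
qed

section \<open>The diagram permutations\<close>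

text \<open>The row-form of \<open>w\<^bsub>D(a)\<^esub>\<close>, namely \<open>[1, a+1, 2, \<dots>, a-1, a+2, \<dots>, r+1, a, r+2]\<close>.\<close>

definition D_perm :: "nat \<Rightarrow> nat \<Rightarrow> nat \<Rightarrow> nat" where
  "D_perm r a k = (if k = 2 then a + 1 else if 3 \<le> k \<and> k \<le> a then k - 1
     else if 3 \<le> k \<and> k \<le> r then k + 1 else if k = r + 1 then a else k)"

lemma D_perm_permutes:
  assumes a: "2 \<le> a" "a \<le> r"
  shows "D_perm r a permutes {1..r + 2}"
proof (rule bij_imp_permutes)
  have "inj_on (D_perm r a) {1..r + 2}"
    using a by (auto simp: inj_on_def D_perm_def split: if_splits)
  moreover have "D_perm r a ` {1..r + 2} \<subseteq> {1..r + 2}"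
    using a by (auto simp: D_perm_def)
  ultimately show "bij_betw (D_perm r a) {1..r + 2} {1..r + 2}"
    by (simp add: bij_betw_def endo_inj_surj)
  show "D_perm r a k = k" if "k \<notin> {1..r + 2}" for k
    using that a by (auto simp: D_perm_def)
qed

text \<open>Away from positions 2 and \<open>r + 1\<close> the entries increase. The entry
  \<open>a + 1\<close> at 2 exceeds those at 3 to \<open>a\<close>, and the entry \<open>a\<close>
  at \<open>r + 1\<close> is exceeded by those at \<open>a + 1\<close> to \<open>r\<close> and by
  the one at 2.\<close>

lemma D_perm_inversions:
  assumes r: "r \<ge> 3" and a: "2 \<le> a" "a \<le> r"
  shows "inversions (r + 2) (D_perm r a) =
    {(2, q) | q. 3 \<le> q \<and> q \<le> a} \<union> {(p, r + 1) | p. a < p \<and> p \<le> r} \<union> {(2, r + 1)}"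
proof -
  have "D_perm r a q < D_perm r a p \<longleftrightarrow>
      (p = 2 \<and> q \<le> a) \<or> (a < p \<and> p \<le> r \<and> q = r + 1) \<or> (p = 2 \<and> q = r + 1)"
    if pq: "1 \<le> p" "p < q" "q \<le> r + 2" for p q
  proof -
    consider "p = 1" | "p = 2" | "3 \<le> p" "p \<le> a" | "a < p" "3 \<le> p" "p \<le> r" | "p = r + 1"
      using pq by fastforce
    then show ?thesis by cases (use pq assms in \<open>auto simp: D_perm_def\<close>)
  qed
  then show ?thesis using assms by (fastforce simp: inversions_def)
qed

text \<open>No chain entry separates positions \<open>r + 1\<close> and 2, as they carry the
  consecutive values \<open>a\<close> and \<open>a + 1\<close>.\<close>

lemma D_perm_in_Z_set:
  assumes r: "r \<ge> 3" and a: "2 \<le> a" "a \<le> r"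
  shows "D_perm r a \<in> Z_set ([2] @ replicate (r - 2) 1 @ [2])"
  unfolding Z_set_composition_iff[OF r] using D_perm_permutes[OF a] assms
  by (auto simp: D_perm_def chain_positions_def)

text \<open>As \<open>a\<close> grows, the family of inversions \<open>(2, q)\<close> with
  \<open>q \<le> r\<close> grows while that of the inversions \<open>(p, r + 1)\<close> with
  \<open>p > 2\<close> shrinks.\<close>

lemma D_perm_inversions_subset_imp_eq:
  assumes r: "r \<ge> 3" and a: "2 \<le> a" "a \<le> r" and b: "2 \<le> b" "b \<le> r"
    and sub: "inversions (r + 2) (D_perm r a) \<subseteq> inversions (r + 2) (D_perm r b)"
  shows "a = b"
proof (rule antisym)
  note inv_a = D_perm_inversions[OF r a] and inv_b = D_perm_inversions[OF r b]
  show "a \<le> b"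
  proof (cases "a \<ge> 3")
    case True
    then have "(2, a) \<in> inversions (r + 2) (D_perm r b)"
      using sub unfolding inv_a by blast
    then show ?thesis unfolding inv_b using a r by auto
  qed (use a b in simp)
  show "b \<le> a"
  proof (cases "a < r")
    case True
    then have "(a + 1, r + 1) \<in> inversions (r + 2) (D_perm r b)"
      using sub unfolding inv_a by auto
    then show ?thesis unfolding inv_b using a r by auto
  qed (use a b in simp)
qed

text \<open>Counting the values below \<open>a = min (e 2) (e (r + 1))\<close>, which are all taken at positions
  \<open>1, 3, \<dots>, r\<close> and in increasing order, locates every inversion of \<open>e\<close>.\<close>

lemma Z_set_inversions_subset_D_perm:
  assumes r: "r \<ge> 3" and e: "e \<in> Z_set ([2] @ replicate (r - 2) 1 @ [2])"
  obtains a where "2 \<le> a" "a \<le> r" "inversions (r + 2) e \<subseteq> inversions (r + 2) (D_perm r a)"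
proof -
  let ?C = "chain_positions r"
  have perm: "e permutes {1..r + 2}" and asc: "e 1 < e 2" "e (r + 1) < e (r + 2)"
    and mono: "\<And>p q. p \<in> ?C \<Longrightarrow> q \<in> ?C \<Longrightarrow> p < q \<Longrightarrow> e p < e q"
    and gap: "\<And>c. c \<in> ?C \<Longrightarrow> e (r + 1) < e c \<Longrightarrow> e 2 < e c"
    using e unfolding Z_set_composition_iff[OF r] by blast+
  have C: "1 \<in> ?C" "r + 2 \<in> ?C" "\<And>p. 3 \<le> p \<Longrightarrow> p \<le> r \<Longrightarrow> p \<in> ?C"
    by (auto simp: chain_positions_def)
  have neq: "e p \<noteq> e q" if "p \<noteq> q" for p q
    using permutes_inj[OF perm] that by (simp add: inj_eq)
  have range: "1 \<le> e p" "e p \<le> r + 2" if "1 \<le> p" "p \<le> r + 2" for p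
    using permutes_in_image[OF perm, of p] that by auto
  \<comment> \<open>The minimum serves both orders of the two entries: a chain entry below
    \<open>e 2\<close> is below \<open>a\<close> by \<open>gap\<close>, and one above
    \<open>e (r + 1)\<close> is above \<open>a\<close>.\<close>
  define a where "a = min (e 2) (e (r + 1))"
  have "e 1 \<noteq> e (r + 1)" using neq[of 1 "r + 1"] r by simp
  then have e1: "e 1 < e (r + 1)" using gap[OF C(1)] asc(1) by (metis less_asym linorder_neqE_nat)
  have en: "e 2 < e (r + 2)" using gap[OF C(2) asc(2)] .
  have e2: "e 2 \<noteq> e (r + 1)" using neq[of 2 "r + 1"] r by simp
  \<comment> \<open>Both entries exceed \<open>e 1\<close>, and they are distinct and below
    \<open>e (r + 2)\<close>, so the smaller one is at most \<open>r\<close>.\<close>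
  have "2 \<le> a" "a \<le> r"
    using e1 en asc e2 range[of 1] range[of "r + 2"] by (auto simp: a_def)
  note a = this
  have "inversions (r + 2) e \<subseteq> inversions (r + 2) (D_perm r a)"
  proof (rule subrelI)
    fix p q assume "(p, q) \<in> inversions (r + 2) e"
    then have pq: "1 \<le> p" "p < q" "q \<le> r + 2" "e q < e p" by (auto simp: inversions_def)
    have first: "e 1 < e k" if k: "1 < k" "k \<le> r + 2" for k
    proof -
      consider "k = 2" | "k = r + 1" | "k \<in> ?C"
        using k by (fastforce simp: chain_positions_def)
      then show ?thesis using asc(1) e1 mono[OF C(1) _ k(1)] by cases auto
    qed
    have last: "e k < e (r + 2)" if k: "1 \<le> k" "k < r + 2" for k
    proof -
      consider "k = 2" | "k = r + 1" | "k \<in> ?C"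
        using k by (fastforce simp: chain_positions_def)
      then show ?thesis using asc(2) en mono[OF _ C(2) k(2)] by cases auto
    qed
    \<comment> \<open>Position 1 holds the least entry, position \<open>r + 2\<close> the greatest,
      and the chain increases; so an inversion starts at 2 or ends at \<open>r + 1\<close>.\<close>
    have "p \<noteq> 1" using first[of q] pq by auto
    moreover have "q \<noteq> r + 2" using last[of p] pq by auto
    moreover have "\<not> (3 \<le> p \<and> q \<le> r)" using mono[of p q] C(3)[of p] C(3)[of q] pq by auto
    ultimately consider "p = 2" "q = r + 1" | "p = 2" "3 \<le> q" "q \<le> r" | "3 \<le> p" "p \<le> r" "q = r + 1"
      using pq by fastforce
    then show "(p, q) \<in> inversions (r + 2) (D_perm r a)"
    proof cases
      case 1
      then show ?thesis unfolding D_perm_inversions[OF r a] by simp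
    next
      case 2
      then have "e q < a" using gap[OF C(3), of q] pq neq[of "r + 1" q] by (fastforce simp: a_def)
      \<comment> \<open>The \<open>q - 1\<close> positions 1, 3, ..., \<open>q\<close> carry values
        from 1 to \<open>a - 1\<close>, whence \<open>q \<le> a\<close>.\<close>
      then have "e k < a" if "k \<in> insert 1 {3..q}" for k
        using that 2 mono[of k q] C by (cases "k = q") force+
      then have "e ` insert 1 {3..q} \<subseteq> {1..<a}"
        using range 2 by fastforce
      then have "card (e ` insert 1 {3..q}) \<le> a - 1" using card_mono[of "{1..<a}"] by fastforce
      moreover have "card (e ` insert 1 {3..q}) = q - 1"
        unfolding card_image[OF inj_on_subset[OF permutes_inj[OF perm] subset_UNIV]] using 2 by simp
      ultimately have "q \<le> a" using \<open>2 \<le> a\<close> by linarith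
      then show ?thesis using 2 unfolding D_perm_inversions[OF r a] by simp
    next
      case 3
      then have p: "a < e p" using gap[OF C(3), of p] pq by (auto simp: a_def)
      \<comment> \<open>Dually, all values from 1 to \<open>a - 1\<close> occur among the
        \<open>p - 2\<close> chain positions before \<open>p\<close>, whence
        \<open>a < p\<close>.\<close>
      have "\<exists>k. k \<in> insert 1 {3..<p} \<and> v = e k" if v: "v \<in> {1..<a}" for v
      proof -
        have "v \<in> {1..r + 2}" using v \<open>a \<le> r\<close> by simp
        then obtain k where k: "k \<in> {1..r + 2}" "v = e k"
          using permutes_image[OF perm] by (metis imageE)
        have "k \<noteq> 2" "k \<noteq> r + 1" using k v by (auto simp: a_def)
        moreover have "k \<noteq> r + 2" using k v asc(2) by (auto simp: a_def)
        moreover have "\<not> (p \<le> k \<and> k \<le> r)"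
          using mono[OF C(3) C(3), of p k] 3 k v p by (cases "k = p") auto
        ultimately show ?thesis using k by (intro exI[of _ k]) auto
      qed
      then have "{1..<a} \<subseteq> e ` insert 1 {3..<p}" by blast
      then have "a - 1 \<le> card (insert 1 {3..<p})"
        using surj_card_le[of "insert 1 {3..<p}" "{1..<a}" e] by simp
      then have "a < p" using 3 \<open>2 \<le> a\<close> by simp
      then show ?thesis using 3 unfolding D_perm_inversions[OF r a] by simp
    qed
  qed
  with a show thesis by (rule that)
qed

text \<open>The permutation \<open>w\<close> maps the indices of the selected nodes onto
  \<open>{1..w k}\<close>. With \<open>w = id\<close> this evaluates the filling by rows, with
  \<open>w = D_perm r a\<close> the filling by columns.\<close>

lemma card_rank_eq:
  fixes w :: "nat \<Rightarrow> nat"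
  assumes v: "bij_betw v {1..n} D" and w: "w permutes {1..n}" and k: "k \<in> {1..n}"
    and le: "\<And>l. l \<in> {1..n} \<Longrightarrow> P (v l) \<longleftrightarrow> w l \<le> w k"
  shows "card {e \<in> D. P e} = w k"
proof -
  let ?L = "{l \<in> {1..n}. w l \<le> w k}"
  have "{e \<in> D. P e} = v ` ?L"
    using v le unfolding bij_betw_def by blast
  then have "card {e \<in> D. P e} = card ?L"
    using v by (metis (no_types, lifting) bij_betw_def card_image inj_on_subset mem_Collect_eq subsetI)
  also have "\<dots> = card (w ` ?L)"
    by (rule card_image[symmetric, OF inj_on_subset[OF permutes_inj[OF w] subset_UNIV]])
  also have "w ` ?L = {1..w k}"
  proof (intro equalityI subsetI)
    fix m assume "m \<in> w ` ?L"
    then show "m \<in> {1..w k}" using permutes_in_image[OF w] by fastforce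
  next
    fix m assume m: "m \<in> {1..w k}"
    then have "m \<in> {1..n}" using permutes_in_image[OF w, of k] k by simp
    then obtain l where "l \<in> {1..n}" "m = w l" using permutes_image[OF w] by (metis imageE)
    then show "m \<in> w ` ?L" using m by auto
  qed
  finally show ?thesis by simp
qed

text \<open>The \<open>k\<close>-th node of \<open>D(a)\<close> in row reading. Rows 1 and
  \<open>r\<close> have two nodes each; every row in between has one, node \<open>k\<close> in row
  \<open>k - 1\<close>, which lies in column 1 up to row \<open>a - 1\<close>.\<close>

definition D_node :: "nat \<Rightarrow> nat \<Rightarrow> nat \<Rightarrow> int \<times> int" where
  "D_node r a k = (if k = 1 then (1, 1) else if k = 2 then (1, 2)
     else if k \<le> r then (int k - 1, if k \<le> a then 1 else 2)
     else if k = r + 1 then (int r, 1) else (int r, 2))"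

lemma D_node_le_iff:
  assumes r: "r \<ge> 3" and k: "k \<in> {1..r + 2}" and l: "l \<in> {1..r + 2}"
  shows "fst (D_node r a l) < fst (D_node r a k) \<or>
      fst (D_node r a l) = fst (D_node r a k) \<and> snd (D_node r a l) \<le> snd (D_node r a k) \<longleftrightarrow> l \<le> k"
proof -
  consider "k = 1" | "k = 2" | "3 \<le> k" "k \<le> r" | "k = r + 1" | "k = r + 2"
    using k by fastforce
  then show ?thesis by cases (use l r in \<open>auto simp: D_node_def\<close>)
qed

lemma bij_betw_D_node:
  assumes r: "r \<ge> 3" and a: "2 \<le> a" "a \<le> r"
  shows "bij_betw (D_node r a) {1..r + 2} (D_diag r a)"
proof -
  \<comment> \<open>Equal nodes compare both ways in the row order, hence so do their
    indices.\<close>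
  have "inj_on (D_node r a) {1..r + 2}"
    using D_node_le_iff[OF r] by (intro inj_onI antisym) (metis order_refl)+
  moreover have "D_node r a k \<in> D_diag r a" if "k \<in> {1..r + 2}" for k
  proof -
    consider "k = 1" | "k = 2" | "3 \<le> k" "k \<le> a" | "a < k" "3 \<le> k" "k \<le> r" | "k = r + 1" | "k = r + 2"
      using \<open>k \<in> _\<close> by fastforce
    then show ?thesis by cases (use assms in \<open>auto simp: D_node_def D_diag_def\<close>)
  qed
  moreover have "d \<in> D_node r a ` {1..r + 2}" if "d \<in> D_diag r a" for d
  proof -
    obtain i j where d: "d = (i, j)" by (metis prod.exhaust)
    have "(j = 1 \<and> 1 \<le> i \<and> i \<le> int a - 1) \<or> (j = 2 \<and> int a \<le> i \<and> i \<le> int r)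
      \<or> (i = int r \<and> j = 1) \<or> (i = 1 \<and> j = 2)"
      using that unfolding d D_diag_def by blast
    then consider "i = 1" "j = 1" | "i = 1" "j = 2" | "i = int r" "j = 1" | "i = int r" "j = 2"
      | "2 \<le> i" "i \<le> int a - 1" "j = 1" | "2 \<le> i" "int a \<le> i" "i < int r" "j = 2"
      using a by linarith
    then show ?thesis
    proof cases
      case 1
      then have "d = D_node r a 1" by (simp add: d D_node_def)
      then show ?thesis by simp
    next
      case 2
      then have "d = D_node r a 2" using r by (simp add: d D_node_def)
      then show ?thesis by simp
    next
      case 3
      then have "d = D_node r a (r + 1)" using r by (simp add: d D_node_def)
      then show ?thesis by simp
    next
      case 4
      then have "d = D_node r a (r + 2)" using r a by (simp add: d D_node_def)
      then show ?thesis by simp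
    next
      case 5
      then obtain m where "i = int m" by (cases i) auto
      then have "d = D_node r a (m + 1)" "m + 1 \<in> {1..r + 2}"
        using 5 a by (auto simp: d D_node_def)
      then show ?thesis by blast
    next
      case 6
      then obtain m where "i = int m" by (cases i) auto
      then have "d = D_node r a (m + 1)" "m + 1 \<in> {1..r + 2}"
        using 6 a by (auto simp: d D_node_def)
      then show ?thesis by blast
    qed
  qed
  ultimately show ?thesis unfolding bij_betw_def by blast
qed

lemma diagram_perm_D_diag:
  assumes r: "r \<ge> 3" and a: "2 \<le> a" "a \<le> r"
  shows "diagram_perm (D_diag r a) = D_perm r a"
proof -
  let ?D = "D_diag r a" and ?v = "D_node r a"
  have v: "bij_betw ?v {1..r + 2} ?D" using assms by (rule bij_betw_D_node)
  then have card: "card ?D = r + 2" using bij_betw_same_card by fastforce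
  have w: "D_perm r a permutes {1..r + 2}" using a by (rule D_perm_permutes)
  have row: "row_filling ?D (?v k) = k" if k: "k \<in> {1..r + 2}" for k
  proof -
    have "fst (?v l) < fst (?v k) \<or> fst (?v l) = fst (?v k) \<and> snd (?v l) \<le> snd (?v k) \<longleftrightarrow>
        id l \<le> id k" if "l \<in> {1..r + 2}" for l
      using D_node_le_iff[OF r k that] by (simp only: id_apply)
    from card_rank_eq[OF v permutes_id k this] show ?thesis
      unfolding row_filling_def id_apply .
  qed
  \<comment> \<open>\<open>u m\<close> is the \<open>m\<close>-th node in column reading: column 1
    has rows 1 to \<open>a - 1\<close> and then \<open>r\<close>, column 2 has row 1 and then rows
    \<open>a\<close> to \<open>r\<close>, which explains the shift \<open>m - 2\<close>.\<close>
  define u :: "nat \<Rightarrow> int \<times> int" where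
    "u m = (if m < a then (int m, 1) else if m = a then (int r, 1)
      else if m = a + 1 then (1, 2) else (int m - 2, 2))" for m
  have vu: "?v k = u (D_perm r a k)" if k: "k \<in> {1..r + 2}" for k
  proof -
    consider "k = 1" | "k = 2" | "3 \<le> k" "k \<le> a" | "a < k" "3 \<le> k" "k \<le> r" | "k = r + 1" | "k = r + 2"
      using k by fastforce
    then show ?thesis by cases (use assms in \<open>auto simp: D_node_def D_perm_def u_def\<close>)
  qed
  have u_mono: "snd (u l) < snd (u m) \<or> snd (u l) = snd (u m) \<and> fst (u l) \<le> fst (u m) \<longleftrightarrow> l \<le> m"
    if "l \<in> {1..r + 2}" "m \<in> {1..r + 2}" for l m
    using that a by (auto simp: u_def)
  have col: "col_filling ?D (?v k) = D_perm r a k" if k: "k \<in> {1..r + 2}" for k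
  proof -
    have "snd (?v l) < snd (?v k) \<or> snd (?v l) = snd (?v k) \<and> fst (?v l) \<le> fst (?v k) \<longleftrightarrow>
        D_perm r a l \<le> D_perm r a k" if l: "l \<in> {1..r + 2}" for l
      unfolding vu[OF k] vu[OF l]
      by (rule u_mono) (use permutes_in_image[OF w] k l in blast)+
    from card_rank_eq[OF v w k this] show ?thesis
      unfolding col_filling_def .
  qed
  have D: "?D = ?v ` {1..r + 2}" using v by (simp add: bij_betw_def)
  show ?thesis
    unfolding diagram_perm_def card
  proof (rule the_equality)
    show "D_perm r a \<in> carrier (rsym (r + 2)) \<and>
        (\<forall>d\<in>?D. D_perm r a (row_filling ?D d) = col_filling ?D d)"
    proof (intro conjI ballI)
      show "D_perm r a \<in> carrier (rsym (r + 2))" using w unfolding carrier_rsym mem_Collect_eq .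
      fix d assume "d \<in> ?D"
      then obtain k where "d = ?v k" "k \<in> {1..r + 2}" unfolding D by (rule imageE)
      then show "D_perm r a (row_filling ?D d) = col_filling ?D d" using row col by metis
    qed
    fix z assume z: "z \<in> carrier (rsym (r + 2)) \<and> (\<forall>d\<in>?D. z (row_filling ?D d) = col_filling ?D d)"
    have "z k = D_perm r a k" for k
    proof (cases "k \<in> {1..r + 2}")
      case True
      then have "?v k \<in> ?D" unfolding D by (rule imageI)
      then show ?thesis using z row[OF True] col[OF True] by metis
    next
      case False
      then show ?thesis
        using z permutes_not_in[OF _ False] w unfolding carrier_rsym mem_Collect_eq by metis
    qed
    then show "z = D_perm r a" ..
  qed
qed

section \<open>The maximal elements of \<open>Z_set\<close> in the prefix order\<close>

theorem proposition3p11: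
  fixes r :: nat and lam :: "nat list"
  assumes "r \<ge> 3"
    and "lam = [2] @ replicate (r - 2) 1 @ [2]"
  shows "Y_set lam = {diagram_perm (D_diag r a) | a. 2 \<le> a \<and> a \<le> r}"
proof -
  have n: "sum_list lam = r + 2" using assms sum_list_composition[of r] by simp
  have perm: "e permutes {1..r + 2}" if "e \<in> Z_set lam" for e
    using that unfolding assms(2) Z_set_composition_iff[OF assms(1)] by blast
  have prefix: "cox_prefix (sum_list lam) x y \<longleftrightarrow> inversions (r + 2) x \<subseteq> inversions (r + 2) y"
    if "x \<in> Z_set lam" "y \<in> Z_set lam" for x y
    unfolding n using that by (intro cox_prefix_iff_inversions_subset perm)
  have below: "\<exists>a. 2 \<le> a \<and> a \<le> r \<and> inversions (r + 2) x \<subseteq> inversions (r + 2) (D_perm r a)"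
    if "x \<in> Z_set lam" for x
    using Z_set_inversions_subset_D_perm[OF assms(1)] that unfolding assms(2) by metis
  have D: "D_perm r a \<in> Z_set lam" if "2 \<le> a" "a \<le> r" for a
    using D_perm_in_Z_set[OF assms(1) that] by (simp only: assms(2))
  have "Y_set lam = {D_perm r a | a. 2 \<le> a \<and> a \<le> r}"
  proof (intro equalityI subsetI)
    fix x assume "x \<in> Y_set lam"
    then have x: "x \<in> Z_set lam" and max: "\<And>y. y \<in> Z_set lam \<Longrightarrow> cox_prefix (sum_list lam) x y \<Longrightarrow> y = x"
      by (auto simp: Y_set_def)
    from below[OF x] obtain a where a: "2 \<le> a" "a \<le> r"
      "inversions (r + 2) x \<subseteq> inversions (r + 2) (D_perm r a)" by blast
    then have "D_perm r a = x" using max D prefix[OF x] by blast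
    then show "x \<in> {D_perm r a | a. 2 \<le> a \<and> a \<le> r}" using a by blast
  next
    fix x assume "x \<in> {D_perm r a | a. 2 \<le> a \<and> a \<le> r}"
    then obtain a where a: "x = D_perm r a" "2 \<le> a" "a \<le> r" by blast
    then have x: "x \<in> Z_set lam" using D by blast
    have "y = x" if y: "y \<in> Z_set lam" and "cox_prefix (sum_list lam) x y" for y
    proof -
      have xy: "inversions (r + 2) x \<subseteq> inversions (r + 2) y" using that prefix[OF x y] by blast
      from below[OF y] obtain b where b: "2 \<le> b" "b \<le> r"
        "inversions (r + 2) y \<subseteq> inversions (r + 2) (D_perm r b)" by blast
      \<comment> \<open>From \<open>x\<close> below \<open>y\<close> below \<open>D_perm r b\<close>
        the inversions of \<open>D_perm r a\<close> lie among those of \<open>D_perm r b\<close>;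
        incomparability then makes all three inversion sets coincide.\<close>
      have "a = b"
        by (rule D_perm_inversions_subset_imp_eq[OF assms(1) a(2,3) b(1,2)])
           (use xy b(3) a(1) in blast)
      then have "inversions (r + 2) y = inversions (r + 2) x" using xy b(3) a(1) by blast
      then show ?thesis by (rule inversions_inject[OF perm[OF y] perm[OF x]])
    qed
    then show "x \<in> Y_set lam" using x by (auto simp: Y_set_def)
  qed
  also have "\<dots> = {diagram_perm (D_diag r a) | a. 2 \<le> a \<and> a \<le> r}"
    using diagram_perm_D_diag[OF assms(1)] by metis
  finally show ?thesis .
qed

end
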